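(* With the notation below, $\hat G=\hat N\alpha\hat B\sqcup\hat B$. Moreover, for $n_1,n_2\in\hat N$ one has $n_1\alpha\hat B\cap n_2\alpha\hat B\neq\varnothing$ if and only if $n_1\hat H=n_2\hat H$.
   Context: Let $F$ be a non-archimedean local field with ring of integers $\mathfrak{o}$, uniformizer $\varpi$, and finite residue field of cardinality $q$. $X=X_{PGL_2(F)}$ is the Bruhat–Tits tree of $PGL_2(F)$: vertices are homothety classes of $\mathfrak{o}$-lattices in $F^2$, with $[L],[L']$ adjacent iff there are representatives with $\varpi L\subsetneq L'\subsetneq L$; it is $(q+1)$-regular. $d$ is the path-length distance; $\mathrm{Aut}(X)$ is the group of distance-preserving bijections of the vertex set with the topology of pointwise convergence, and $PGL_2(F)\hookrightarrow\mathrm{Aut}(X)$ via the linear action on lattices. For an edge $\eta=\{y_1,y_2\}$ and $e\ge1$, $B(\eta,e)=\{y:\min(d(y,y_1),d(y,y_2))\le e\}$, and $\hat G=\hat G^{(e)}=\{g\in\mathrm{Aut}(X):\forall\eta\ \exists g'\in PGL_2(F),\ g|_{B(\eta,e)}=g'|_{B(\eta,e)}\}$ for a fixed $e\ge1$. Ends are equivalence classes of infinite paths (agreeing after an index shift from some point on). Fix a doubly infinite path $(x_n)_{n\in\mathbb{Z}}$; let $\omega$ be the end of $(x_n)_{n\ge0}$ and $\omega'$ the end of $(x_{-n})_{n\ge0}$. Set $\hat B=\{g\in\hat G: g(\omega)=\omega\}$, $\hat N=\{b\in\hat B: b(x_i)=x_i\text{ for some }i\in\mathbb{Z}\}$, $\hat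 H=\{n\in\hat N: n(x_k)=x_k\ \forall k\in\mathbb{Z}\}$. Fix $\alpha\in\hat G$ with $\alpha(x_n)=x_{-n}$ for all $n\in\mathbb{Z}$ (such $\alpha$ exists). *)

theory Defs
  imports Main
begin

text \<open>The valuation v is only meaningful on nonzero elements; val_ge v x n means v(x) >= n
  with the convention v(0) = infinity.\<close>

definition val_ge :: "('f::field \<Rightarrow> int) \<Rightarrow> 'f \<Rightarrow> int \<Rightarrow> bool" where
  "val_ge v x n \<longleftrightarrow> x = 0 \<or> n \<le> v x"

definition integers :: "('f::field \<Rightarrow> int) \<Rightarrow> 'f set" where
  "integers v = {x. val_ge v x 0}"

definition maxideal :: "('f::field \<Rightarrow> int) \<Rightarrow> 'f set" where
  "maxideal v = {x. val_ge v x 1}"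

definition nonarch_local_field :: "('f::field \<Rightarrow> int) \<Rightarrow> bool" where
  "nonarch_local_field v \<longleftrightarrow>
     (\<forall>x y. x \<noteq> 0 \<longrightarrow> y \<noteq> 0 \<longrightarrow> v (x * y) = v x + v y) \<and>
     (\<forall>x y. x \<noteq> 0 \<longrightarrow> y \<noteq> 0 \<longrightarrow> x + y \<noteq> 0 \<longrightarrow> min (v x) (v y) \<le> v (x + y)) \<and>
     (\<exists>p. p \<noteq> 0 \<and> v p = 1) \<and>
     (\<forall>s :: nat \<Rightarrow> 'f.
        (\<forall>N. \<exists>M. \<forall>m\<ge>M. \<forall>n\<ge>M. val_ge v (s m - s n) N) \<longrightarrow>
        (\<exists>l. \<forall>N. \<exists>M. \<forall>n\<ge>M. val_ge v (s n - l) N)) \<and>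
     finite ((\<lambda>x. {y \<in> integers v. x - y \<in> maxideal v}) ` integers v)"

definition uniformizer :: "('f::field \<Rightarrow> int) \<Rightarrow> 'f" where
  "uniformizer v = (SOME p. p \<noteq> 0 \<and> v p = 1)"

definition vsmult :: "'f::field \<Rightarrow> 'f \<times> 'f \<Rightarrow> 'f \<times> 'f" where
  "vsmult c u = (c * fst u, c * snd u)"

definition vadd :: "'f::field \<times> 'f \<Rightarrow> 'f \<times> 'f \<Rightarrow> 'f \<times> 'f" where
  "vadd u w = (fst u + fst w, snd u + snd w)"

definition lattice :: "('f::field \<Rightarrow> int) \<Rightarrow> ('f \<times> 'f) set \<Rightarrow> bool" where
  "lattice v L \<longleftrightarrow> (\<exists>u w. fst u * snd w - snd u * fst w \<noteq> 0 \<and>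
      L = {vadd (vsmult a u) (vsmult b w) | a b. a \<in> integers v \<and> b \<in> integers v})"

definition hclass :: "('f::field \<times> 'f) set \<Rightarrow> ('f \<times> 'f) set set" where
  "hclass L = {vsmult c ` L | c. c \<noteq> 0}"

definition vertices :: "('f::field \<Rightarrow> int) \<Rightarrow> ('f \<times> 'f) set set set" where
  "vertices v = {hclass L | L. lattice v L}"

definition adjacent :: "('f::field \<Rightarrow> int) \<Rightarrow> ('f \<times> 'f) set set \<Rightarrow> ('f \<times> 'f) set set \<Rightarrow> bool" where
  "adjacent v X Y \<longleftrightarrow> X \<in> vertices v \<and> Y \<in> vertices v \<and>
     (\<exists>L\<in>X. \<exists>L'\<in>Y. vsmult (uniformizer v) ` L \<subset> L' \<and> L' \<subset> L)"

definition tdist :: "('f::field \<Rightarrow> int) \<Rightarrow> ('f \<times> 'f) set set \<Rightarrow> ('f \<times> 'f) set set \<Rightarrow> nat" where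
  "tdist v X Y = (LEAST n. \<exists>p. p 0 = X \<and> p n = Y \<and> (\<forall>i<n. adjacent v (p i) (p (Suc i))))"

text \<open>Aut(X): distance-preserving bijections of the vertex set (extended by the identity
  outside the vertex set, so that composition of maps is composition of functions).\<close>
definition Aut :: "('f::field \<Rightarrow> int) \<Rightarrow> (('f \<times> 'f) set set \<Rightarrow> ('f \<times> 'f) set set) set" where
  "Aut v = {g. bij_betw g (vertices v) (vertices v) \<and> (\<forall>X. X \<notin> vertices v \<longrightarrow> g X = X) \<and>
     (\<forall>X\<in>vertices v. \<forall>Y\<in>vertices v. tdist v (g X) (g Y) = tdist v X Y)}"

definition mdet :: "'f::field \<times> 'f \<times> 'f \<times> 'f \<Rightarrow> 'f" where
  "mdet M = (case M of (a, b, c, d) \<Rightarrow> a * d - b * c)"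

definition matvec :: "'f::field \<times> 'f \<times> 'f \<times> 'f \<Rightarrow> 'f \<times> 'f \<Rightarrow> 'f \<times> 'f" where
  "matvec M u = (case M of (a, b, c, d) \<Rightarrow> (a * fst u + b * snd u, c * fst u + d * snd u))"

definition pgl_act :: "('f::field \<Rightarrow> int) \<Rightarrow> 'f \<times> 'f \<times> 'f \<times> 'f \<Rightarrow> ('f \<times> 'f) set set \<Rightarrow> ('f \<times> 'f) set set" where
  "pgl_act v M X = (if X \<in> vertices v then (\<lambda>L. matvec M ` L) ` X else X)"

text \<open>The image of PGL_2(F) (equivalently of GL_2(F)) in Aut(X).\<close>
definition PGL :: "('f::field \<Rightarrow> int) \<Rightarrow> (('f \<times> 'f) set set \<Rightarrow> ('f \<times> 'f) set set) set" where
  "PGL v = {pgl_act v M | M. mdet M \<noteq> 0}"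

definition ball_edge :: "('f::field \<Rightarrow> int) \<Rightarrow> ('f \<times> 'f) set set \<Rightarrow> ('f \<times> 'f) set set \<Rightarrow> nat \<Rightarrow> ('f \<times> 'f) set set set" where
  "ball_edge v y1 y2 e = {y \<in> vertices v. min (tdist v y y1) (tdist v y y2) \<le> e}"

definition Ghat :: "('f::field \<Rightarrow> int) \<Rightarrow> nat \<Rightarrow> (('f \<times> 'f) set set \<Rightarrow> ('f \<times> 'f) set set) set" where
  "Ghat v e = {g \<in> Aut v. \<forall>y1 y2. adjacent v y1 y2 \<longrightarrow>
       (\<exists>g'\<in>PGL v. \<forall>y\<in>ball_edge v y1 y2 e. g y = g' y)}"

definition ray_equiv :: "(nat \<Rightarrow> 'a) \<Rightarrow> (nat \<Rightarrow> 'a) \<Rightarrow> bool" where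
  "ray_equiv p q \<longleftrightarrow> (\<exists>i j. \<forall>n. p (i + n) = q (j + n))"

definition fixes_end :: "('a \<Rightarrow> 'a) \<Rightarrow> (int \<Rightarrow> 'a) \<Rightarrow> bool" where
  "fixes_end g x \<longleftrightarrow> ray_equiv (\<lambda>n. g (x (int n))) (\<lambda>n. x (int n))"

definition doubly_inf_path :: "('f::field \<Rightarrow> int) \<Rightarrow> (int \<Rightarrow> ('f \<times> 'f) set set) \<Rightarrow> bool" where
  "doubly_inf_path v x \<longleftrightarrow> (\<forall>n. adjacent v (x n) (x (n + 1))) \<and> (\<forall>n. x (n + 2) \<noteq> x n)"

definition Bhat :: "('f::field \<Rightarrow> int) \<Rightarrow> nat \<Rightarrow> (int \<Rightarrow> ('f \<times> 'f) set set) \<Rightarrow> (('f \<times> 'f) set set \<Rightarrow> ('f \<times> 'f) set set) set" where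
  "Bhat v e x = {g \<in> Ghat v e. fixes_end g x}"

definition Nhat :: "('f::field \<Rightarrow> int) \<Rightarrow> nat \<Rightarrow> (int \<Rightarrow> ('f \<times> 'f) set set) \<Rightarrow> (('f \<times> 'f) set set \<Rightarrow> ('f \<times> 'f) set set) set" where
  "Nhat v e x = {b \<in> Bhat v e x. \<exists>i. b (x i) = x i}"

definition Hhat :: "('f::field \<Rightarrow> int) \<Rightarrow> nat \<Rightarrow> (int \<Rightarrow> ('f \<times> 'f) set set) \<Rightarrow> (('f \<times> 'f) set set \<Rightarrow> ('f \<times> 'f) set set) set" where
  "Hhat v e x = {n \<in> Nhat v e x. \<forall>k. n (x k) = x k}"

end

(* Identify vertices with balls {y. v (y - c) >= n} in F: neighbours are balls contained in one
   another with radii one step apart. A path without backtracking that once shrinks keeps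
   shrinking, so by completeness a bi-infinite path either grows forever (its end is infinity) or
   eventually shrinks to a point c of F; an element of PGL_2 moves any end to infinity. With omega
   at infinity, an element of Bhat sends ascending paths to ascending paths, and since enlarging a
   ball is deterministic, b x_i = x_j forces b x_(i+n) = x_(j+n). If g does not fix omega, then
   g x shrinks to some c', and the translation n taking omega' to c' lies in Nhat; alpha^-1 n^-1 g
   then fixes omega. Finally n = alpha b alpha^-1 with n in Nhat and b in Bhat shifts both tails of
   x, by 0 on the omega side, hence by 0 everywhere, so that n lies in Hhat. *)

theory Submission
  imports Defs
begin

locale nonarch_field =
  fixes v :: "'f::field \<Rightarrow> int"
  assumes local_field: "nonarch_local_field v"
begin

section \<open>Ultrametric arithmetic and completeness\<close>

section \<open>Valuation\<close>

lemma v_mult: "x \<noteq> 0 \<Longrightarrow> y \<noteq> 0 \<Longrightarrow> v (x * y) = v x + v y"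
  using local_field unfolding nonarch_local_field_def by blast

lemma v_one [simp]: "v 1 = 0"
  using v_mult[of 1 1] by simp

lemma v_minus: "v (- x) = v x"
proof (cases "x = 0")
  case False
  have "v (- 1) = 0" using v_mult[of "-1" "-1"] by simp
  then show ?thesis using v_mult[of "-1" x] False by simp
qed simp

lemma v_inverse: "x \<noteq> 0 \<Longrightarrow> v (inverse x) = - v x"
  using v_mult[of x "inverse x"] by simp

lemma val_ge_zero [simp]: "val_ge v 0 n"
  by (simp add: val_ge_def)

lemma val_ge_mono: "val_ge v x n \<Longrightarrow> m \<le> n \<Longrightarrow> val_ge v x m"
  by (auto simp: val_ge_def)

lemma val_ge_minus [simp]: "val_ge v (- x) n = val_ge v x n"
  by (simp add: val_ge_def v_minus)

lemma val_ge_add: "val_ge v x n \<Longrightarrow> val_ge v y n \<Longrightarrow> val_ge v (x + y) n"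
proof -
  assume "val_ge v x n" "val_ge v y n"
  moreover have "x \<noteq> 0 \<longrightarrow> y \<noteq> 0 \<longrightarrow> x + y \<noteq> 0 \<longrightarrow> min (v x) (v y) \<le> v (x + y)"
    using local_field unfolding nonarch_local_field_def by blast
  ultimately show ?thesis by (auto simp: val_ge_def)
qed

lemma val_ge_diff: "val_ge v x n \<Longrightarrow> val_ge v y n \<Longrightarrow> val_ge v (x - y) n"
  using val_ge_add[of x n "- y"] by simp

lemma val_ge_commute: "val_ge v (x - y) n \<longleftrightarrow> val_ge v (y - x) n"
  using val_ge_minus[of "x - y" n] by simp

lemma val_ge_trans: "val_ge v (x - y) n \<Longrightarrow> val_ge v (y - z) n \<Longrightarrow> val_ge v (x - z) n"
  using val_ge_add[of "x - y" n "y - z"] by simp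

lemma val_ge_mult: "val_ge v x m \<Longrightarrow> val_ge v y n \<Longrightarrow> val_ge v (x * y) (m + n)"
  by (cases "x = 0"; cases "y = 0") (auto simp: val_ge_def v_mult)

lemma val_ge_mult_iff: "t \<noteq> 0 \<Longrightarrow> val_ge v (t * x) n \<longleftrightarrow> val_ge v x (n - v t)"
  by (cases "x = 0") (auto simp: val_ge_def v_mult)

lemma val_ge_divide_iff: "t \<noteq> 0 \<Longrightarrow> val_ge v (x / t) n \<longleftrightarrow> val_ge v x (n + v t)"
  using val_ge_mult_iff[of "inverse t" x n] by (simp add: v_inverse divide_inverse mult.commute)

lemma exists_val_ge: "\<exists>N. \<forall>n\<le>N. val_ge v x n"
  by (auto simp: val_ge_def)

lemma uniformizer_props: "uniformizer v \<noteq> 0" "v (uniformizer v) = 1"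
proof -
  have "\<exists>p. p \<noteq> 0 \<and> v p = 1"
    using local_field unfolding nonarch_local_field_def by blast
  then have "uniformizer v \<noteq> 0 \<and> v (uniformizer v) = 1"
    unfolding uniformizer_def by (rule someI_ex)
  then show "uniformizer v \<noteq> 0" "v (uniformizer v) = 1" by auto
qed

lemma exists_valuation: "\<exists>t. t \<noteq> 0 \<and> v t = n"
proof (induction n rule: int_induct[where k = 0])
  case base
  then show ?case by (intro exI[of _ 1]) simp
next
  case (step1 i)
  then obtain t where "t \<noteq> 0" "v t = i" by blast
  then show ?case using uniformizer_props
    by (intro exI[of _ "t * uniformizer v"]) (simp add: v_mult)
next
  case (step2 i)
  then obtain t where "t \<noteq> 0" "v t = i" by blast
  then show ?case using uniformizer_props
    by (intro exI[of _ "t * inverse (uniformizer v)"]) (simp add: v_mult v_inverse)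
qed

text \<open>Consecutive estimates telescope without loss by the ultrametric inequality, so
  \<open>s\<close> is a Cauchy sequence. Its limit serves as the common centre: a sufficiently late
  term is within \<open>k + int m\<close> of both the limit and \<open>s m\<close>.\<close>

lemma nested_balls_have_center:
  assumes "\<And>m. val_ge v (s (Suc m) - s m) (k + int m)"
  obtains c where "\<And>m. val_ge v (s m - c) (k + int m)"
proof -
  have tail: "val_ge v (s (m + j) - s m) (k + int m)" for m j
  proof (induction j)
    case (Suc j)
    have "val_ge v (s (Suc (m + j)) - s (m + j)) (k + int m)"
      using assms[of "m + j"] by (rule val_ge_mono) simp
    from val_ge_trans[OF this Suc] show ?case by simp
  qed simp
  have cauchy: "\<forall>N. \<exists>M. \<forall>m\<ge>M. \<forall>n\<ge>M. val_ge v (s m - s n) N"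
  proof (intro allI exI impI)
    fix N and m n :: nat
    \<comment> \<open>From index \<open>nat (N - k)\<close> on, the bound \<open>k + int m\<close>
      is at least \<open>N\<close>; the index is 0 when \<open>N\<close> is below
      \<open>k\<close>.\<close>
    assume "nat (N - k) \<le> m" "nat (N - k) \<le> n"
    then have "val_ge v (s m - s (nat (N - k))) N" "val_ge v (s n - s (nat (N - k))) N"
      using tail[of "nat (N - k)" "m - nat (N - k)"] tail[of "nat (N - k)" "n - nat (N - k)"]
      by (auto elim!: val_ge_mono)
    then show "val_ge v (s m - s n) N"
      using val_ge_diff by fastforce
  qed
  have "\<forall>s :: nat \<Rightarrow> 'f.
        (\<forall>N. \<exists>M. \<forall>m\<ge>M. \<forall>n\<ge>M. val_ge v (s m - s n) N) \<longrightarrow>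
        (\<exists>l. \<forall>N. \<exists>M. \<forall>n\<ge>M. val_ge v (s n - l) N)"
    using local_field unfolding nonarch_local_field_def by blast
  with cauchy obtain c where c: "\<forall>N. \<exists>M. \<forall>n\<ge>M. val_ge v (s n - c) N"
    by blast
  have "val_ge v (s m - c) (k + int m)" for m
  proof -
    obtain M where "\<forall>n\<ge>M. val_ge v (s n - c) (k + int m)"
      using c by blast
    then have "val_ge v (s (m + M) - c) (k + int m)" by simp
    moreover have "val_ge v (s m - s (m + M)) (k + int m)"
      using tail[of m M] val_ge_commute by blast
    ultimately show ?thesis using val_ge_trans by blast
  qed
  then show thesis using that by blast
qed

section \<open>Normal form of lattices, and adjacency of balls\<close>

section \<open>Vertices as balls\<close>

text \<open>Up to homothety, every lattice is spanned by \<open>(t, 0)\<close> and \<open>(c, 1)\<close>, where \<open>v t = n\<close>; its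
  class corresponds to the ball \<open>{y. v (y - c) \<ge> n}\<close>. The parameter \<open>m\<close> is the scaling.\<close>

definition ball_lattice :: "'f \<Rightarrow> int \<Rightarrow> int \<Rightarrow> ('f \<times> 'f) set" where
  "ball_lattice c n m = {(s, b). val_ge v b m \<and> val_ge v (s - b * c) (n + m)}"

definition ball_vertex :: "'f \<Rightarrow> int \<Rightarrow> ('f \<times> 'f) set set" where
  "ball_vertex c n = hclass (ball_lattice c n 0)"

lemma vsmult_image: "t \<noteq> 0 \<Longrightarrow> vsmult t ` L = {(s, b). (s / t, b / t) \<in> L}"
  by (force simp: vsmult_def image_iff)

lemma vsmult_ball_lattice:
  assumes "t \<noteq> 0"
  shows "vsmult t ` ball_lattice c n m = ball_lattice c n (m + v t)"
proof -
  have "s / t - b / t * c = (s - b * c) / t" for s b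
    using assms by (simp add: field_simps)
  then show ?thesis
    using assms by (simp add: vsmult_image ball_lattice_def val_ge_divide_iff add.assoc)
qed

text \<open>The valuation takes every integer value, so homotheties of one lattice reach every
  scaling \<open>m\<close>.\<close>

lemma ball_vertex_eq: "ball_vertex c n = range (ball_lattice c n)"
proof -
  have "ball_lattice c n m \<in> hclass (ball_lattice c n 0)" for m
  proof -
    obtain t where "t \<noteq> 0" "v t = m" using exists_valuation by blast
    then show ?thesis unfolding hclass_def
      using vsmult_ball_lattice[of t c n 0] by (intro CollectI exI[of _ t]) simp
  qed
  then show ?thesis
    unfolding ball_vertex_def by (auto simp: hclass_def vsmult_ball_lattice)
qed

text \<open>Inclusion is tested on the generators \<open>(t * c, t)\<close> and
  \<open>(r, 0)\<close>, where \<open>v t = m\<close> and \<open>v r = n + m\<close>. Conversely,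
  \<open>s - b * d\<close> is the sum of \<open>s - b * c\<close> and \<open>b * (c - d)\<close>,
  both of valuation at least \<open>k + l\<close>.\<close>

lemma ball_lattice_subset_iff:
  "ball_lattice c n m \<subseteq> ball_lattice d k l \<longleftrightarrow>
     l \<le> m \<and> k + l \<le> n + m \<and> val_ge v (c - d) (k + l - m)" (is "?L \<longleftrightarrow> ?R")
proof
  assume L: ?L
  obtain t where t: "t \<noteq> 0" "v t = m" using exists_valuation by blast
  obtain r where r: "r \<noteq> 0" "v r = n + m" using exists_valuation by blast
  have "(t * c, t) \<in> ball_lattice c n m" "(r, 0) \<in> ball_lattice c n m"
    using t r by (auto simp: ball_lattice_def val_ge_def)
  then have "(t * c, t) \<in> ball_lattice d k l" "(r, 0) \<in> ball_lattice d k l"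
    using L by auto
  then have "val_ge v t l" "val_ge v (t * (c - d)) (k + l)" "val_ge v r (k + l)"
    by (auto simp: ball_lattice_def algebra_simps)
  then show ?R using t r by (auto simp: val_ge_mult_iff) (auto simp: val_ge_def)
next
  assume R: ?R
  show ?L
  proof (clarsimp simp: ball_lattice_def)
    fix s b assume b: "val_ge v b m" and s: "val_ge v (s - b * c) (n + m)"
    have "val_ge v (b * (c - d)) (m + (k + l - m))"
      using b R val_ge_mult by blast
    then have "val_ge v ((s - b * c) + b * (c - d)) (k + l)"
      using val_ge_mono[OF s] R by (intro val_ge_add) auto
    then show "val_ge v b l \<and> val_ge v (s - b * d) (k + l)"
      using val_ge_mono[OF b] R by (simp add: algebra_simps)
  qed
qed

lemma ball_lattice_eq_iff:
  "ball_lattice c n m = ball_lattice d k l \<longleftrightarrow> n = k \<and> m = l \<and> val_ge v (c - d) n"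
  unfolding set_eq_subset ball_lattice_subset_iff
  by (smt (verit) val_ge_commute)

lemma ball_vertex_eq_iff: "ball_vertex c n = ball_vertex d k \<longleftrightarrow> n = k \<and> val_ge v (c - d) n"
  unfolding ball_vertex_eq
proof
  assume "range (ball_lattice c n) = range (ball_lattice d k)"
  then have "ball_lattice c n 0 \<in> range (ball_lattice d k)" by blast
  then show "n = k \<and> val_ge v (c - d) n" by (auto simp: ball_lattice_eq_iff)
next
  assume "n = k \<and> val_ge v (c - d) n"
  then have "ball_lattice c n m = ball_lattice d k m" for m
    by (auto simp: ball_lattice_eq_iff)
  then show "range (ball_lattice c n) = range (ball_lattice d k)" by auto
qed

lemma lattice_ball_lattice: "lattice v (ball_lattice c n 0)"
proof -
  obtain t where t: "t \<noteq> 0" "v t = n" using exists_valuation by blast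
  have "ball_lattice c n 0 =
    {vadd (vsmult a (t, 0)) (vsmult b (c, 1)) |a b. a \<in> integers v \<and> b \<in> integers v}"
  proof (intro equalityI subsetI)
    fix z assume "z \<in> ball_lattice c n 0"
    then obtain s b where z: "z = (s, b)" "val_ge v b 0" "val_ge v (s - b * c) n"
      by (auto simp: ball_lattice_def)
    then have "z = vadd (vsmult ((s - b * c) / t) (t, 0)) (vsmult b (c, 1))"
      using t by (simp add: vadd_def vsmult_def)
    moreover have "(s - b * c) / t \<in> integers v" "b \<in> integers v"
      using z t by (auto simp: integers_def val_ge_divide_iff)
    ultimately show "z \<in> {vadd (vsmult a (t, 0)) (vsmult b (c, 1)) |a b.
        a \<in> integers v \<and> b \<in> integers v}" by blast
  next
    fix z assume "z \<in> {vadd (vsmult a (t, 0)) (vsmult b (c, 1)) |a b.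
        a \<in> integers v \<and> b \<in> integers v}"
    then obtain a b where "z = (t * a + b * c, b)" "val_ge v a 0" "val_ge v b 0"
      by (auto simp: integers_def vadd_def vsmult_def mult.commute)
    then show "z \<in> ball_lattice c n 0"
      using t by (simp add: ball_lattice_def val_ge_mult_iff)
  qed
  then show ?thesis unfolding lattice_def
    using t by (intro exI[of _ "(t, 0)"] exI[of _ "(c, 1)"]) simp
qed

lemma ball_vertex_in_vertices [simp]: "ball_vertex c n \<in> vertices v"
  unfolding ball_vertex_def vertices_def using lattice_ball_lattice by blast

text \<open>One step of Gaussian elimination: \<open>snd u\<close> is an integral multiple
  \<open>g\<close> of \<open>snd w\<close>, so subtracting \<open>g\<close> times \<open>w\<close>
  from \<open>u\<close> leaves \<open>(f, 0)\<close>, while \<open>w\<close> is \<open>t\<close>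
  times \<open>(c, 1)\<close>.\<close>

lemma lattice_span_ball:
  assumes det: "fst u * snd w - snd u * fst w \<noteq> 0" and w: "snd w \<noteq> 0"
    and le: "val_ge v (snd u) (v (snd w))"
    and L: "L = {vadd (vsmult a u) (vsmult b w) | a b. a \<in> integers v \<and> b \<in> integers v}"
  shows "\<exists>c n m. L = ball_lattice c n m"
proof -
  define t where "t = snd w"
  define c where "c = fst w / t"
  define g where "g = snd u / t"
  define f where "f = fst u - snd u * c"
  have t: "t \<noteq> 0" and w_eq: "w = (t * c, t)"
    using w by (auto simp: t_def c_def prod_eq_iff)
  have u_eq: "u = (f + t * g * c, t * g)"
    using t by (simp add: f_def g_def prod_eq_iff)
  have g: "val_ge v g 0" using le t by (simp add: g_def t_def val_ge_divide_iff)
  have f: "f \<noteq> 0"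
  proof
    assume "f = 0"
    then show False using det u_eq w_eq by (simp add: algebra_simps)
  qed
  have "L = ball_lattice c (v f - v t) (v t)"
  proof (intro equalityI subsetI)
    fix z assume "z \<in> L"
    then obtain a b where ab: "val_ge v a 0" "val_ge v b 0"
      and z: "z = vadd (vsmult a u) (vsmult b w)"
      using L by (auto simp: integers_def)
    have "val_ge v (a * g + b) 0"
      using val_ge_mult[OF ab(1) g] ab(2) val_ge_add by simp
    moreover have "z = (f * a + t * (a * g + b) * c, t * (a * g + b))"
      unfolding z u_eq w_eq by (simp add: vadd_def vsmult_def algebra_simps)
    ultimately show "z \<in> ball_lattice c (v f - v t) (v t)"
      using ab f t by (simp add: ball_lattice_def val_ge_mult_iff)
  next
    fix z assume "z \<in> ball_lattice c (v f - v t) (v t)"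
    then obtain s b where z: "z = (s, b)" "val_ge v b (v t)" "val_ge v (s - b * c) (v f)"
      by (auto simp: ball_lattice_def)
    define a where "a = (s - b * c) / f"
    define b' where "b' = b / t - a * g"
    have a: "val_ge v a 0" using z f by (simp add: a_def val_ge_divide_iff)
    have "val_ge v (b / t) 0" using z t by (simp add: val_ge_divide_iff)
    then have b': "val_ge v b' 0"
      using val_ge_mult[OF a g] val_ge_diff by (simp add: b'_def)
    have "b = a * (t * g) + b' * t" using t by (simp add: b'_def algebra_simps)
    moreover have "s = a * f + b * c" using f by (simp add: a_def)
    ultimately have "z = vadd (vsmult a u) (vsmult b' w)"
      unfolding z u_eq w_eq by (simp add: vadd_def vsmult_def algebra_simps)
    then show "z \<in> L" using a b' L by (auto simp: integers_def)
  qed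
  then show ?thesis by blast
qed

lemma lattice_is_ball_lattice:
  assumes "lattice v L"
  obtains c n m where "L = ball_lattice c n m"
proof -
  obtain u w where det: "fst u * snd w - snd u * fst w \<noteq> 0"
    and L: "L = {vadd (vsmult a u) (vsmult b w) | a b. a \<in> integers v \<and> b \<in> integers v}"
    using assms unfolding lattice_def by blast
  have L': "L = {vadd (vsmult a w) (vsmult b u) | a b. a \<in> integers v \<and> b \<in> integers v}"
    unfolding L by (auto simp: vadd_def add.commute) (metis add.commute)+
  have "\<exists>c n m. L = ball_lattice c n m"
  proof (cases "snd w \<noteq> 0 \<and> val_ge v (snd u) (v (snd w))")
    case True
    then show ?thesis using lattice_span_ball[OF det _ _ L] by blast
  next
    case False
    \<comment> \<open>The second coordinates cannot both vanish, since the determinant is nonzero.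
      Swapping \<open>u\<close> and \<open>w\<close> puts the one of least valuation in second
      place.\<close>
    then have "snd u \<noteq> 0 \<and> val_ge v (snd w) (v (snd u))"
      using det by (auto simp: val_ge_def)
    moreover have "fst w * snd u - snd w * fst u \<noteq> 0"
      using det by (auto simp: algebra_simps)
    ultimately show ?thesis using lattice_span_ball[OF _ _ _ L'] by blast
  qed
  then show thesis using that by blast
qed

lemma hclass_ball_lattice: "hclass (ball_lattice c n m) = ball_vertex c n"
proof -
  have "ball_lattice c n l \<in> hclass (ball_lattice c n m)" for l
  proof -
    obtain t where "t \<noteq> 0" "v t = l - m" using exists_valuation by blast
    then show ?thesis unfolding hclass_def
      using vsmult_ball_lattice[of t c n m] by (intro CollectI exI[of _ t]) simp
  qed
  then show ?thesis
    unfolding ball_vertex_eq by (auto simp: hclass_def vsmult_ball_lattice)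
qed

lemma vertices_eq: "X \<in> vertices v \<longleftrightarrow> (\<exists>c n. X = ball_vertex c n)"
proof
  assume "X \<in> vertices v"
  then obtain L where "X = hclass L" "lattice v L" unfolding vertices_def by blast
  then show "\<exists>c n. X = ball_vertex c n"
    by (metis lattice_is_ball_lattice hclass_ball_lattice)
qed auto

text \<open>The uniformizer raises the scaling by 1, so the chain of inclusions forces
  \<open>l = m\<close> or \<open>l = m + 1\<close>. Strictness then leaves a ball one step smaller
  in the first case and one step larger in the second.\<close>

lemma adjacent_ball_vertex:
  "adjacent v (ball_vertex c n) (ball_vertex d k) \<longleftrightarrow>
     (k = n + 1 \<and> val_ge v (c - d) n) \<or> (n = k + 1 \<and> val_ge v (c - d) k)"
proof -
  have "adjacent v (ball_vertex c n) (ball_vertex d k) \<longleftrightarrow>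
    (\<exists>m l. ball_lattice c n (m + 1) \<subset> ball_lattice d k l \<and> ball_lattice d k l \<subset> ball_lattice c n m)"
    unfolding adjacent_def
    by (simp, simp add: ball_vertex_eq vsmult_ball_lattice uniformizer_props)
  also have "\<dots> \<longleftrightarrow> (k = n + 1 \<and> val_ge v (c - d) n) \<or> (n = k + 1 \<and> val_ge v (c - d) k)"
    (is "?L \<longleftrightarrow> ?R")
  proof
    assume ?L
    then obtain m l where s: "ball_lattice c n (m + 1) \<subset> ball_lattice d k l"
        "ball_lattice d k l \<subset> ball_lattice c n m" by blast
    then have le: "l \<le> m + 1" "k + l \<le> n + m + 1" "m \<le> l" "n + m \<le> k + l"
      and val: "val_ge v (c - d) (k + l - m - 1)" "val_ge v (c - d) (n + m - l)"
      unfolding psubset_eq ball_lattice_subset_iff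
      by (auto simp: val_ge_commute[of d c] algebra_simps)
    have ne: "\<not> (n = k \<and> m + 1 = l \<and> val_ge v (c - d) n)"
      "\<not> (k = n \<and> l = m \<and> val_ge v (c - d) n)"
      using s unfolding psubset_eq ball_lattice_eq_iff by (auto simp: val_ge_commute[of d c])
    show ?R
    proof (cases "l = m")
      case True
      then have "val_ge v (c - d) n" using val(2) by simp
      moreover have "k = n \<or> k = n + 1" using le True by linarith
      ultimately show ?thesis using ne(2) True by blast
    next
      case False
      then have l: "l = m + 1" using le by simp
      then have "val_ge v (c - d) k" using val(1) by simp
      moreover have "n = k \<or> n = k + 1" using le l by linarith
      ultimately show ?thesis using ne(1) l by blast
    qed
  next
    assume ?R
    then show ?L
    proof
      assume "k = n + 1 \<and> val_ge v (c - d) n"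
      then show ?L
        by (intro exI[of _ 0])
           (auto simp: psubset_eq ball_lattice_subset_iff ball_lattice_eq_iff val_ge_commute[of d c])
    next
      assume "n = k + 1 \<and> val_ge v (c - d) k"
      then show ?L
        by (intro exI[of _ 0] exI[of _ 1])
           (auto simp: psubset_eq ball_lattice_subset_iff ball_lattice_eq_iff val_ge_commute[of d c])
    qed
  qed
  finally show ?thesis .
qed

lemma adjacent_cases:
  assumes "adjacent v X Y"
  obtains c n d k where "X = ball_vertex c n" "Y = ball_vertex d k"
    "(k = n + 1 \<and> val_ge v (c - d) n) \<or> (n = k + 1 \<and> val_ge v (c - d) k)"
proof -
  have "X \<in> vertices v" "Y \<in> vertices v" using assms unfolding adjacent_def by auto
  then obtain c n d k where XY: "X = ball_vertex c n" "Y = ball_vertex d k"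
    unfolding vertices_eq by blast
  show thesis using that[OF XY] assms unfolding XY adjacent_ball_vertex .
qed

lemma adjacent_sym: "adjacent v X Y \<Longrightarrow> adjacent v Y X"
proof (erule adjacent_cases)
  fix c n d k assume "X = ball_vertex c n" "Y = ball_vertex d k"
    "(k = n + 1 \<and> val_ge v (c - d) n) \<or> (n = k + 1 \<and> val_ge v (c - d) k)"
  then show ?thesis
    by (simp add: adjacent_ball_vertex val_ge_commute[of d c] disj_commute)
qed

lemma adjacent_neq: "adjacent v X Y \<Longrightarrow> X \<noteq> Y"
  by (erule adjacent_cases) (auto simp: ball_vertex_eq_iff)

section \<open>Shape of paths without backtracking\<close>

section \<open>Bi-infinite paths\<close>

text \<open>Without backtracking, a path that once steps down to a smaller ball keeps doing so. So a
  bi-infinite path either always goes up, or is eventually a nested sequence of balls shrinking to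
  some \<open>c\<close>.\<close>

lemma path_dichotomy:
  assumes "doubly_inf_path v x"
  obtains (ascending) k c where "\<And>i. x i = ball_vertex c (k - i)"
  | (descending) i k c where "\<And>m. x (i + int m) = ball_vertex c (k + int m)"
proof -
  have adj: "adjacent v (x i) (x (i + 1))" and nb: "x (i + 2) \<noteq> x i" for i
    using assms by (auto simp: doubly_inf_path_def)
  have "\<exists>c n. x i = ball_vertex c n" for i
    using adj[of i] vertices_eq unfolding adjacent_def by blast
  then obtain c l where x: "\<And>i. x i = ball_vertex (c i) (l i)" by metis
  have step: "(l (i + 1) = l i + 1 \<and> val_ge v (c i - c (i + 1)) (l i)) \<or>
      (l i = l (i + 1) + 1 \<and> val_ge v (c i - c (i + 1)) (l (i + 1)))" for i
    using adj[of i] unfolding x adjacent_ball_vertex .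
  \<comment> \<open>A ball is contained in exactly one ball of the next larger size. Going down and
    then up would therefore return to \<open>x i\<close>.\<close>
  have persist: "l (i + 2) = l (i + 1) + 1" if "l (i + 1) = l i + 1" for i
  proof (rule ccontr)
    assume "l (i + 2) \<noteq> l (i + 1) + 1"
    moreover have "i + 1 + 1 = i + 2" by simp
    note step[of "i + 1", unfolded this]
    ultimately have "l (i + 2) = l i" "val_ge v (c (i + 1) - c (i + 2)) (l i)"
      using that by auto
    moreover have "val_ge v (c i - c (i + 1)) (l i)" using step[of i] that by auto
    ultimately have "x i = x (i + 2)"
      unfolding x ball_vertex_eq_iff using val_ge_trans by metis
    then show False using nb[of i] by simp
  qed
  show thesis
  proof (cases "\<exists>i. l (i + 1) = l i + 1")
    case True
    then obtain i where i: "l (i + 1) = l i + 1" by blast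
    have down: "l (i + int m + 1) = l (i + int m) + 1" for m
    proof (induction m)
      case (Suc m)
      then show ?case using persist[of "i + int m"] by (simp add: add.commute add.left_commute)
    qed (simp add: i)
    have l: "l (i + int m) = l i + int m" for m
    proof (induction m)
      case (Suc m)
      then show ?case using down[of m] by (simp add: add.commute add.left_commute)
    qed simp
    have "val_ge v (c (i + int (Suc m)) - c (i + int m)) (l i + int m)" for m
      using step[of "i + int m"] down[of m] l[of m]
        val_ge_commute[of "c (i + int (Suc m))" "c (i + int m)"]
      by (auto simp: add.commute add.left_commute)
    then obtain d where "\<And>m. val_ge v (c (i + int m) - d) (l i + int m)"
      using nested_balls_have_center[of "\<lambda>m. c (i + int m)"] by blast
    then show thesis
      by (intro descending[of i d "l i"]) (simp add: x ball_vertex_eq_iff l)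
  next
    case False
    then have up: "l i = l (i + 1) + 1" and c: "val_ge v (c i - c (i + 1)) (l (i + 1))" for i
      using step[of i] by auto
    define L where "L = l 0"
    have l: "l i = L - i" for i
    proof (induction i rule: int_induct[where k = 0])
      case (step1 i)
      then show ?case using up[of i] by simp
    next
      case (step2 i)
      then show ?case using up[of "i - 1"] by simp
    qed (simp add: L_def)
    \<comment> \<open>Read backwards, an ascending path is a nested sequence of shrinking balls, so
      completeness provides a common centre \<open>d\<close> for the nonpositive indices.\<close>
    have "val_ge v (c (- int (Suc m)) - c (- int m)) (L + int m)" for m
      using c[of "- int (Suc m)"] l[of "- int m"] by simp
    then obtain d where d: "\<And>m. val_ge v (c (- int m) - d) (L + int m)"
      using nested_balls_have_center[of "\<lambda>m. c (- int m)"] by blast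
    \<comment> \<open>At positive indices the balls only grow, so they still contain
      \<open>d\<close>.\<close>
    have pos: "val_ge v (c (int m) - d) (L - int m)" for m
    proof (induction m)
      case 0
      then show ?case using d[of 0] by simp
    next
      case (Suc m)
      have "val_ge v (c (int (Suc m)) - c (int m)) (L - int (Suc m))"
        using c[of "int m"] l[of "int (Suc m)"] val_ge_commute by (simp add: add.commute)
      moreover have "val_ge v (c (int m) - d) (L - int (Suc m))"
        using Suc by (rule val_ge_mono) simp
      ultimately show ?case by (rule val_ge_trans)
    qed
    have "val_ge v (c i - d) (L - i)" for i
      using d[of "nat (- i)"] pos[of "nat i"] by (cases "0 \<le> i") auto
    then show thesis
      by (intro ascending[of d "L"]) (auto simp: x ball_vertex_eq_iff l)
  qed
qed

section \<open>Connectedness of the tree, and the group \<open>Aut\<close>\<close>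

section \<open>Automorphisms\<close>

text \<open>Both vertices climb to a common ball: below the level \<open>N\<close> the balls around
  \<open>c\<close> and around \<open>d\<close> coincide. Connectedness ensures that the
  \<open>LEAST\<close> in \<open>tdist\<close> is attained by a path.\<close>

lemma adjacent_connected:
  assumes "X \<in> vertices v" "Y \<in> vertices v"
  shows "(adjacent v)\<^sup>*\<^sup>* X Y"
proof -
  have climb: "(adjacent v)\<^sup>*\<^sup>* (ball_vertex c n) (ball_vertex c (n - int m))" for c n m
  proof (induction m)
    case (Suc m)
    have "adjacent v (ball_vertex c (n - int m)) (ball_vertex c (n - int (Suc m)))"
      by (simp add: adjacent_ball_vertex)
    then show ?case using Suc by (rule rtranclp.rtrancl_into_rtrancl[rotated])
  qed simp
  obtain c n d k where XY: "X = ball_vertex c n" "Y = ball_vertex d k"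
    using assms unfolding vertices_eq by blast
  obtain N where N: "\<forall>m\<le>N. val_ge v (c - d) m" using exists_val_ge by blast
  define l where "l = min N (min n k)"
  have l_le: "l \<le> n" "l \<le> k" by (simp_all add: l_def)
  have "ball_vertex c l = ball_vertex d l" using N by (simp add: ball_vertex_eq_iff l_def)
  moreover have "(adjacent v)\<^sup>*\<^sup>* X (ball_vertex c l)"
    using climb[of c n "nat (n - l)"] XY by (simp add: l_le)
  moreover have "(adjacent v)\<^sup>*\<^sup>* Y (ball_vertex d l)"
    using climb[of d k "nat (k - l)"] XY by (simp add: l_le)
  moreover have "symp (adjacent v)\<^sup>*\<^sup>*"
    by (rule symp_rtranclp) (blast intro: sympI dest: adjacent_sym)
  ultimately show ?thesis by (metis sympD rtranclp_trans)
qed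

lemma tdist_eq_relpowp: "tdist v X Y = (LEAST n. (adjacent v ^^ n) X Y)"
  unfolding tdist_def relpowp_fun_conv by (rule refl)

text \<open>This turns preservation of distance into preservation of adjacency. For the converse
  direction, connectedness gives a path realizing the distance 1.\<close>

lemma adjacent_iff_tdist:
  assumes "X \<in> vertices v" "Y \<in> vertices v"
  shows "adjacent v X Y \<longleftrightarrow> tdist v X Y = 1"
proof
  assume A: "adjacent v X Y"
  show "tdist v X Y = 1" unfolding tdist_eq_relpowp
  proof (rule Least_equality)
    fix n assume "(adjacent v ^^ n) X Y"
    then show "1 \<le> n" using adjacent_neq[OF A] by (cases n) auto
  qed (use A in auto)
next
  assume "tdist v X Y = 1"
  moreover have "\<exists>n. (adjacent v ^^ n) X Y"
    using adjacent_connected[OF assms] by (simp add: rtranclp_power)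
  then have "(adjacent v ^^ tdist v X Y) X Y"
    unfolding tdist_eq_relpowp by (rule LeastI_ex)
  ultimately show "adjacent v X Y" by auto
qed

lemma Aut_vertices [simp]: "g \<in> Aut v \<Longrightarrow> g X \<in> vertices v \<longleftrightarrow> X \<in> vertices v"
proof (cases "X \<in> vertices v")
  case True
  assume "g \<in> Aut v"
  then have "bij_betw g (vertices v) (vertices v)" unfolding Aut_def by blast
  then show ?thesis using True bij_betw_apply by metis
next
  case False
  assume "g \<in> Aut v"
  then have "g X = X" using False unfolding Aut_def by blast
  then show ?thesis by simp
qed

lemma Aut_tdist:
  "g \<in> Aut v \<Longrightarrow> X \<in> vertices v \<Longrightarrow> Y \<in> vertices v \<Longrightarrow> tdist v (g X) (g Y) = tdist v X Y"
  unfolding Aut_def by blast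

text \<open>Being the identity off the vertex set makes \<open>g\<close> a bijection of the whole
  type, so \<open>inv g\<close> is its group inverse.\<close>

lemma Aut_bij: "g \<in> Aut v \<Longrightarrow> bij g"
proof -
  assume g: "g \<in> Aut v"
  then have "bij_betw g (- vertices v) (- vertices v)"
    by (intro bij_betw_byWitness[where f' = g]) (auto simp: Aut_def)
  moreover have "bij_betw g (vertices v) (vertices v)" using g by (simp add: Aut_def)
  ultimately show "bij g" using bij_betw_combine[of g "vertices v" "vertices v" "- vertices v" "- vertices v"] by simp
qed

lemma Aut_adjacent: "g \<in> Aut v \<Longrightarrow> adjacent v X Y \<Longrightarrow> adjacent v (g X) (g Y)"
proof -
  assume g: "g \<in> Aut v" and adj: "adjacent v X Y"
  then have "X \<in> vertices v" "Y \<in> vertices v" by (auto simp: adjacent_def)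
  then show ?thesis using g adj by (simp add: adjacent_iff_tdist Aut_tdist)
qed

lemma Aut_comp: "g \<in> Aut v \<Longrightarrow> h \<in> Aut v \<Longrightarrow> g \<circ> h \<in> Aut v"
proof -
  assume g: "g \<in> Aut v" and h: "h \<in> Aut v"
  then have "bij_betw (g \<circ> h) (vertices v) (vertices v)"
    unfolding Aut_def by (elim CollectE conjE) (rule bij_betw_trans)
  moreover have "(g \<circ> h) X = X" if "X \<notin> vertices v" for X
    using g h that by (simp add: Aut_def)
  ultimately show ?thesis using g h by (simp add: Aut_def Aut_tdist[OF g] Aut_vertices[OF h])
qed

lemma Aut_inv:
  assumes g: "g \<in> Aut v"
  shows "inv g \<in> Aut v"
proof -
  note bij = Aut_bij[OF g]
  have vert: "inv g X \<in> vertices v \<longleftrightarrow> X \<in> vertices v" for X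
    using Aut_vertices[OF g, of "inv g X"] bij by (simp add: bij_is_surj surj_f_inv_f)
  have "bij_betw (inv g) (vertices v) (vertices v)"
    by (rule bij_betw_byWitness[where f' = g])
       (use g bij in \<open>auto simp: vert bij_is_surj surj_f_inv_f bij_is_inj\<close>)
  moreover have "inv g X = X" if "X \<notin> vertices v" for X
    using that g bij by (auto simp: Aut_def inv_f_eq bij_is_inj)
  moreover have "tdist v (inv g X) (inv g Y) = tdist v X Y"
    if "X \<in> vertices v" "Y \<in> vertices v" for X Y
    using Aut_tdist[OF g, of "inv g X" "inv g Y"] that bij
    by (simp add: vert bij_is_surj surj_f_inv_f)
  ultimately show ?thesis by (simp add: Aut_def)
qed

text \<open>Mutually inverse maps that preserve adjacency transport walks of each length in both
  directions, so the least length is unchanged.\<close>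

lemma AutI:
  assumes "\<And>X. f (g X) = X" "\<And>X. g (f X) = X"
    and "\<And>X Y. adjacent v X Y \<Longrightarrow> adjacent v (f X) (f Y)"
    and "\<And>X Y. adjacent v X Y \<Longrightarrow> adjacent v (g X) (g Y)"
    and "\<And>X. X \<notin> vertices v \<Longrightarrow> f X = X"
    and "\<And>X. X \<in> vertices v \<Longrightarrow> f X \<in> vertices v"
    and "\<And>X. X \<in> vertices v \<Longrightarrow> g X \<in> vertices v"
  shows "f \<in> Aut v"
proof -
  have pow: "(adjacent v ^^ n) (h X) (h Y)"
    if h: "\<forall>X Y. adjacent v X Y \<longrightarrow> adjacent v (h X) (h Y)" and "(adjacent v ^^ n) X Y" for h n X Y
    using that(2)
  proof (induction n arbitrary: Y)
    case (Suc n)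
    then obtain Z where "(adjacent v ^^ n) X Z" "adjacent v Z Y" by auto
    then show ?case using h Suc.IH by (auto intro: relpowp_Suc_I)
  qed simp
  have "(adjacent v ^^ n) (f X) (f Y) \<longleftrightarrow> (adjacent v ^^ n) X Y" for n X Y
    using pow[of f n X Y] pow[of g n "f X" "f Y"] assms(2,3,4) by auto
  then have "tdist v (f X) (f Y) = tdist v X Y" for X Y
    by (simp add: tdist_eq_relpowp)
  moreover have "bij_betw f (vertices v) (vertices v)"
    by (rule bij_betw_byWitness[where f' = g]) (use assms in auto)
  ultimately show ?thesis using assms(5) by (simp add: Aut_def)
qed

section \<open>Matrices acting on lattice classes, and the group \<open>Ghat\<close>\<close>

section \<open>The action of matrices\<close>

lemma matvec_vsmult: "matvec M (vsmult t u) = vsmult t (matvec M u)"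
  by (cases M) (simp add: matvec_def vsmult_def algebra_simps)

lemma matvec_vadd: "matvec M (vadd u w) = vadd (matvec M u) (matvec M w)"
  by (cases M) (simp add: matvec_def vadd_def algebra_simps)

definition matmul :: "'f \<times> 'f \<times> 'f \<times> 'f \<Rightarrow> 'f \<times> 'f \<times> 'f \<times> 'f \<Rightarrow> 'f \<times> 'f \<times> 'f \<times> 'f" where
  "matmul M N = (case M of (a, b, c, d) \<Rightarrow> case N of (a', b', c', d') \<Rightarrow>
     (a * a' + b * c', a * b' + b * d', c * a' + d * c', c * b' + d * d'))"

lemma matvec_matmul: "matvec (matmul M N) u = matvec M (matvec N u)"
  by (cases M; cases N) (simp add: matmul_def matvec_def algebra_simps)

lemma mdet_matmul: "mdet (matmul M N) = mdet M * mdet N"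
  by (cases M; cases N) (simp add: matmul_def mdet_def algebra_simps)

lemma matrix_inverse:
  fixes M :: "'f \<times> 'f \<times> 'f \<times> 'f"
  assumes "mdet M \<noteq> 0"
  shows "\<exists>N. mdet N \<noteq> 0 \<and> (\<forall>u. matvec M (matvec N u) = u) \<and> (\<forall>u. matvec N (matvec M u) = u)"
proof -
  obtain a b c d where M: "M = (a, b, c, d)" by (cases M)
  define D where "D = a * d - b * c"
  define N where "N = (d / D, - b / D, - c / D, a / D)"
  have D: "D \<noteq> 0" using assms by (simp add: M D_def mdet_def)
  have "matmul M N = (1, 0, 0, 1)" "matmul N M = (1, 0, 0, 1)"
    using D by (simp_all add: M N_def matmul_def field_simps) (simp_all add: D_def field_simps)
  moreover have "matvec (1, 0, 0, 1) u = u" for u :: "'f \<times> 'f"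
    by (simp add: matvec_def)
  ultimately have "matvec M (matvec N u) = u" "matvec N (matvec M u) = u" for u
    by (simp_all flip: matvec_matmul)
  moreover have "mdet N \<noteq> 0"
  proof
    assume "mdet N = 0"
    then have "mdet (matmul M N) = 0" by (simp add: mdet_matmul)
    then show False using \<open>matmul M N = (1, 0, 0, 1)\<close> by (simp add: mdet_def)
  qed
  ultimately show ?thesis by blast
qed

lemma lattice_matvec:
  assumes "mdet M \<noteq> 0" "lattice v L"
  shows "lattice v (matvec M ` L)"
proof -
  obtain u w where det: "fst u * snd w - snd u * fst w \<noteq> 0"
    and L: "L = {vadd (vsmult a u) (vsmult b w) | a b. a \<in> integers v \<and> b \<in> integers v}"
    using assms(2) unfolding lattice_def by blast
  have "fst (matvec M u) * snd (matvec M w) - snd (matvec M u) * fst (matvec M w) =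
      mdet M * (fst u * snd w - snd u * fst w)"
    by (cases M) (simp add: matvec_def mdet_def algebra_simps)
  moreover have "matvec M ` L = {vadd (vsmult a (matvec M u)) (vsmult b (matvec M w)) | a b.
      a \<in> integers v \<and> b \<in> integers v}"
    unfolding L by (force simp: matvec_vadd matvec_vsmult image_iff)
  ultimately show ?thesis unfolding lattice_def using assms(1) det
    by (intro exI[of _ "matvec M u"] exI[of _ "matvec M w"]) simp
qed

text \<open>Linear maps commute with scalars, so the action can be computed on one representative of
  the class.\<close>

lemma pgl_act_hclass:
  assumes "lattice v L"
  shows "pgl_act v M (hclass L) = hclass (matvec M ` L)"
proof -
  have "hclass L \<in> vertices v" using assms unfolding vertices_def by blast
  moreover have "matvec M ` vsmult c ` L = vsmult c ` matvec M ` L" for c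
    by (simp add: image_image matvec_vsmult)
  moreover have "(`) f ` {vsmult c ` L |c. c \<noteq> 0} = {f ` vsmult c ` L |c. c \<noteq> 0}" for f :: "'f \<times> 'f \<Rightarrow> 'f \<times> 'f"
    by blast
  ultimately show ?thesis by (simp only: pgl_act_def hclass_def if_True)
qed

lemma pgl_act_vertices:
  "mdet M \<noteq> 0 \<Longrightarrow> X \<in> vertices v \<Longrightarrow> pgl_act v M X \<in> vertices v"
proof -
  assume M: "mdet M \<noteq> 0" and "X \<in> vertices v"
  then obtain L where L: "X = hclass L" "lattice v L" unfolding vertices_def by blast
  then show ?thesis
    using pgl_act_hclass[OF L(2)] lattice_matvec[OF M L(2)] unfolding vertices_def by auto
qed

lemma pgl_act_comp:
  assumes "mdet N \<noteq> 0"
  shows "pgl_act v M (pgl_act v N X) = pgl_act v (matmul M N) X"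
proof (cases "X \<in> vertices v")
  case True
  then have "pgl_act v N X \<in> vertices v" by (rule pgl_act_vertices[OF assms])
  then show ?thesis using True by (simp add: pgl_act_def image_image matvec_matmul)
qed (simp add: pgl_act_def)

lemma PGL_comp: "g \<in> PGL v \<Longrightarrow> h \<in> PGL v \<Longrightarrow> g \<circ> h \<in> PGL v"
proof -
  assume "g \<in> PGL v" "h \<in> PGL v"
  then obtain M N where "g = pgl_act v M" "mdet M \<noteq> 0" "h = pgl_act v N" "mdet N \<noteq> 0"
    unfolding PGL_def by blast
  then have "g \<circ> h = pgl_act v (matmul M N)" "mdet (matmul M N) \<noteq> 0"
    by (auto simp: pgl_act_comp mdet_matmul)
  then show ?thesis unfolding PGL_def by blast
qed

lemma pgl_act_inverse:
  assumes "mdet M \<noteq> 0"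
  shows "\<exists>N. mdet N \<noteq> 0 \<and> (\<forall>X. pgl_act v M (pgl_act v N X) = X) \<and>
    (\<forall>X. pgl_act v N (pgl_act v M X) = X)"
proof -
  obtain N where N: "mdet N \<noteq> 0"
    "\<forall>u. matvec M (matvec N u) = u" "\<forall>u. matvec N (matvec M u) = u"
    using matrix_inverse[OF assms] by blast
  have MN: "matvec M (matvec N u) = u" and NM: "matvec N (matvec M u) = u" for u
    using N by blast+
  have "pgl_act v M (pgl_act v N X) = X" "pgl_act v N (pgl_act v M X) = X" for X
    using pgl_act_vertices[OF N(1), of X] pgl_act_vertices[OF assms, of X]
    by (auto simp add: pgl_act_def image_image MN NM)
  then show ?thesis using N(1) by blast
qed

lemma pgl_act_adjacent:
  assumes M: "mdet M \<noteq> 0" and "adjacent v X Y"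
  shows "adjacent v (pgl_act v M X) (pgl_act v M Y)"
proof -
  obtain L L' where LL': "L \<in> X" "L' \<in> Y" "vsmult (uniformizer v) ` L \<subset> L'" "L' \<subset> L"
    and XY: "X \<in> vertices v" "Y \<in> vertices v"
    using assms(2) unfolding adjacent_def by blast
  obtain N where "\<forall>u. matvec N (matvec M u) = u" using matrix_inverse[OF M] by blast
  then have inj: "inj (matvec M)" by (intro inj_on_inverseI[of _ "matvec N"]) blast
  have "matvec M ` vsmult (uniformizer v) ` L \<subset> matvec M ` L'" "matvec M ` L' \<subset> matvec M ` L"
    using image_strict_mono[OF inj_on_subset[OF inj subset_UNIV] LL'(3)]
      image_strict_mono[OF inj_on_subset[OF inj subset_UNIV] LL'(4)] by auto
  moreover have "matvec M ` L \<in> pgl_act v M X" "matvec M ` L' \<in> pgl_act v M Y"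
    using LL' XY by (auto simp: pgl_act_def)
  moreover have "vsmult (uniformizer v) ` matvec M ` L = matvec M ` vsmult (uniformizer v) ` L"
    by (simp add: image_image matvec_vsmult)
  ultimately have "\<exists>L\<in>pgl_act v M X. \<exists>L'\<in>pgl_act v M Y.
      vsmult (uniformizer v) ` L \<subset> L' \<and> L' \<subset> L"
    by (intro bexI[of _ "matvec M ` L"] bexI[of _ "matvec M ` L'"]) simp_all
  then show ?thesis
    using pgl_act_vertices[OF M XY(1)] pgl_act_vertices[OF M XY(2)] by (simp add: adjacent_def)
qed

lemma PGL_inverse:
  assumes "g \<in> PGL v"
  shows "\<exists>h\<in>PGL v. (\<forall>X. g (h X) = X) \<and> (\<forall>X. h (g X) = X)"
proof -
  obtain M where M: "g = pgl_act v M" "mdet M \<noteq> 0" using assms unfolding PGL_def by blast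
  obtain N where N: "mdet N \<noteq> 0" "\<forall>X. pgl_act v M (pgl_act v N X) = X"
    "\<forall>X. pgl_act v N (pgl_act v M X) = X" using pgl_act_inverse[OF M(2)] by blast
  from N(1) have "pgl_act v N \<in> PGL v" unfolding PGL_def by blast
  then show ?thesis using N(2,3) unfolding M(1) by blast
qed

text \<open>Around every edge the element is its own local model; membership in \<open>Aut\<close>
  comes from the inverse matrix.\<close>

lemma PGL_Ghat: "g \<in> PGL v \<Longrightarrow> g \<in> Ghat v e"
proof -
  assume g: "g \<in> PGL v"
  then obtain M where M: "g = pgl_act v M" "mdet M \<noteq> 0" unfolding PGL_def by blast
  obtain N where N: "mdet N \<noteq> 0" "\<forall>X. pgl_act v M (pgl_act v N X) = X"
    "\<forall>X. pgl_act v N (pgl_act v M X) = X" using pgl_act_inverse[OF M(2)] by blast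
  have "pgl_act v M \<in> Aut v"
    by (rule AutI[where g = "pgl_act v N"])
       (simp_all add: M N pgl_act_adjacent pgl_act_vertices, simp add: pgl_act_def)
  then show ?thesis using g M(1) by (auto simp: Ghat_def)
qed

lemma Ghat_Aut: "g \<in> Ghat v e \<Longrightarrow> g \<in> Aut v"
  unfolding Ghat_def by (elim CollectE conjE)

lemma Ghat_local:
  assumes "g \<in> Ghat v e" "adjacent v y1 y2"
  shows "\<exists>g'\<in>PGL v. \<forall>y\<in>ball_edge v y1 y2 e. g y = g' y"
  using assms unfolding Ghat_def by blast

text \<open>Since \<open>h\<close> preserves distances, it carries the ball around an edge into the
  ball around the image edge. There the local model of \<open>g\<close> takes over, and the two
  models compose.\<close>

lemma Ghat_comp:
  assumes g: "g \<in> Ghat v e" and h: "h \<in> Ghat v e"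
  shows "g \<circ> h \<in> Ghat v e"
proof -
  note Aut = Ghat_Aut[OF g] Ghat_Aut[OF h]
  have "\<exists>f\<in>PGL v. \<forall>y\<in>ball_edge v y1 y2 e. (g \<circ> h) y = f y" if adj: "adjacent v y1 y2" for y1 y2
  proof -
    have V: "y1 \<in> vertices v" "y2 \<in> vertices v" using adj by (auto simp: adjacent_def)
    obtain h' where h': "h' \<in> PGL v" "\<forall>y\<in>ball_edge v y1 y2 e. h y = h' y"
      using Ghat_local[OF h adj] by blast
    obtain g' where g': "g' \<in> PGL v" "\<forall>y\<in>ball_edge v (h y1) (h y2) e. g y = g' y"
      using Ghat_local[OF g Aut_adjacent[OF Aut(2) adj]] by blast
    have "h y \<in> ball_edge v (h y1) (h y2) e" if "y \<in> ball_edge v y1 y2 e" for y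
      using that Aut V by (auto simp: ball_edge_def Aut_tdist)
    then have "\<forall>y\<in>ball_edge v y1 y2 e. (g \<circ> h) y = (g' \<circ> h') y"
      using g'(2) h'(2) by simp
    then show ?thesis using PGL_comp[OF g'(1) h'(1)] by blast
  qed
  then show ?thesis using Aut_comp[OF Aut] by (simp add: Ghat_def)
qed

lemma Ghat_inv:
  assumes g: "g \<in> Ghat v e"
  shows "inv g \<in> Ghat v e"
proof -
  note Aut = Ghat_Aut[OF g]
  note Aut' = Aut_inv[OF Aut]
  have "\<exists>f\<in>PGL v. \<forall>y\<in>ball_edge v y1 y2 e. inv g y = f y" if adj: "adjacent v y1 y2" for y1 y2
  proof -
    have V: "y1 \<in> vertices v" "y2 \<in> vertices v" using adj by (auto simp: adjacent_def)
    \<comment> \<open>The local model is taken at the preimage edge; its inverse in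
      \<open>PGL\<close> is the model for \<open>inv g\<close>.\<close>
    obtain g' where g': "g' \<in> PGL v" "\<forall>y\<in>ball_edge v (inv g y1) (inv g y2) e. g y = g' y"
      using Ghat_local[OF g Aut_adjacent[OF Aut' adj]] by blast
    obtain f where f: "f \<in> PGL v" "\<forall>X. f (g' X) = X"
      using PGL_inverse[OF g'(1)] by blast
    have "inv g y = f y" if "y \<in> ball_edge v y1 y2 e" for y
    proof -
      have "inv g y \<in> ball_edge v (inv g y1) (inv g y2) e"
        using that Aut' V by (auto simp: ball_edge_def Aut_tdist)
      then have "g' (inv g y) = y"
        using g'(2) Aut_bij[OF Aut] by (metis bij_is_surj surj_f_inv_f)
      then show ?thesis using f(2) by metis
    qed
    then show ?thesis using f(1) by blast
  qed
  then show ?thesis using Aut' by (simp add: Ghat_def)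
qed

lemma Ghat_bij: "g \<in> Ghat v e \<Longrightarrow> bij g"
  by (rule Aut_bij[OF Ghat_Aut])

lemma Ghat_inv_left [simp]: "g \<in> Ghat v e \<Longrightarrow> inv g (g X) = X"
  by (rule inv_f_f[OF bij_is_inj[OF Ghat_bij]])

lemma Ghat_inv_right [simp]: "g \<in> Ghat v e \<Longrightarrow> g (inv g X) = X"
  by (rule surj_f_inv_f[OF bij_is_surj[OF Ghat_bij]])

lemma Ghat_path:
  assumes "g \<in> Ghat v e" "doubly_inf_path v x"
  shows "doubly_inf_path v (g \<circ> x)"
proof -
  have "g \<in> Aut v" using assms(1) by (rule Ghat_Aut)
  moreover have "g X = g Y \<longleftrightarrow> X = Y" for X Y
    using Ghat_bij[OF assms(1)] by (simp add: bij_is_inj inj_eq)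
  ultimately show ?thesis using assms(2) by (simp add: doubly_inf_path_def Aut_adjacent)
qed

section \<open>Fixing an end, and moving an end to infinity\<close>

section \<open>The end of an ascending path\<close>

text \<open>Both tails contain the index \<open>max a b\<close> and its successor, where the level
  would have to drop and rise at once.\<close>

lemma not_ascending_and_descending:
  assumes up: "\<And>n. y (a + int n) = ball_vertex c (k - int n)"
    and down: "\<And>n. y (b + int n) = ball_vertex d (l + int n)"
  shows False
proof -
  define p where "p = nat (b - a)"
  define q where "q = nat (a - b)"
  have "a + int p = b + int q" by (simp add: p_def q_def)
  then have "ball_vertex c (k - int p) = ball_vertex d (l + int q)"
    "ball_vertex c (k - int (Suc p)) = ball_vertex d (l + int (Suc q))"
    using up[of p] down[of q] up[of "Suc p"] down[of "Suc q"] by (simp_all add: algebra_simps)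
  then show False by (simp add: ball_vertex_eq_iff)
qed

text \<open>Discarding a longer initial segment of both tails makes integer offsets nonnegative.
  Integer offsets suit paths indexed by all integers.\<close>

lemma fixes_end_iff: "fixes_end g x \<longleftrightarrow> (\<exists>i j. \<forall>n. g (x (i + int n)) = x (j + int n))"
proof
  assume "fixes_end g x"
  then obtain i j where "\<forall>n. g (x (int (i + n))) = x (int (j + n))"
    unfolding fixes_end_def ray_equiv_def by blast
  then show "\<exists>i j. \<forall>n. g (x (i + int n)) = x (j + int n)"
    by (intro exI[of _ "int i"] exI[of _ "int j"]) simp
next
  assume "\<exists>i j. \<forall>n. g (x (i + int n)) = x (j + int n)"
  then obtain i j where ij: "\<forall>n. g (x (i + int n)) = x (j + int n)" by blast
  define p where "p = nat (max (- i) (- j))"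
  have "0 \<le> i + int p" "0 \<le> j + int p" by (auto simp: p_def max_def)
  then have "g (x (int (nat (i + int p) + n))) = x (int (nat (j + int p) + n))" for n
    using ij[rule_format, of "p + n"] by (simp add: add.assoc)
  then show "fixes_end g x" unfolding fixes_end_def ray_equiv_def by blast
qed

lemma fixes_end_comp:
  assumes "fixes_end g x" "fixes_end h x"
  shows "fixes_end (g \<circ> h) x"
proof -
  obtain i j where g: "\<forall>n. g (x (i + int n)) = x (j + int n)"
    using assms(1) unfolding fixes_end_iff by blast
  obtain k l where h: "\<forall>n. h (x (k + int n)) = x (l + int n)"
    using assms(2) unfolding fixes_end_iff by blast
  define s where "s = nat (i - l)"
  define t where "t = nat (l - i)"
  have st: "l + int s = i + int t" by (simp add: s_def t_def)
  have "(g \<circ> h) (x ((k + int s) + int n)) = x ((j + int t) + int n)" for n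
    using h[rule_format, of "s + n"] g[rule_format, of "t + n"] st
    by (simp add: add.assoc[symmetric])
  then show ?thesis unfolding fixes_end_iff by blast
qed

lemma fixes_end_inv:
  assumes "g \<in> Ghat v e" "fixes_end g x"
  shows "fixes_end (inv g) x"
proof -
  obtain i j where "\<forall>n. g (x (i + int n)) = x (j + int n)"
    using assms(2) unfolding fixes_end_iff by blast
  then have "inv g (x (j + int n)) = x (i + int n)" for n
    using Ghat_inv_left[OF assms(1)] by metis
  then show ?thesis unfolding fixes_end_iff by blast
qed

text \<open>The image path cannot descend, as it shares a tail with \<open>x\<close>. Both paths
  thus ascend and agree at one ball, and each ball has only one enlargement of a given
  level.\<close>

lemma ascending_shift:
  assumes x: "\<And>i. x i = ball_vertex c (k - i)" and path: "doubly_inf_path v x"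
    and b: "b \<in> Ghat v e" "fixes_end b x" and ij: "b (x i) = x j"
  shows "b (x (i + int n)) = x (j + int n)"
proof (rule path_dichotomy[OF Ghat_path[OF b(1) path]])
  fix k' c' assume y: "\<And>i. (b \<circ> x) i = ball_vertex c' (k' - i)"
  have "ball_vertex c' (k' - i) = ball_vertex c (k - j)" using ij y[of i] x[of j] by simp
  then have l: "k' - i = k - j" and "val_ge v (c' - c) (k' - i)"
    by (auto simp: ball_vertex_eq_iff)
  then have "val_ge v (c' - c) (k' - (i + int n))"
    by (elim val_ge_mono) simp
  then have "ball_vertex c' (k' - (i + int n)) = ball_vertex c (k - (j + int n))"
    using l by (simp add: ball_vertex_eq_iff)
  then show ?thesis using y[of "i + int n"] by (simp add: x)
next
  fix i' k' c' assume down: "\<And>m. (b \<circ> x) (i' + int m) = ball_vertex c' (k' + int m)"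
  obtain s t where "\<forall>n. b (x (s + int n)) = x (t + int n)"
    using b(2) unfolding fixes_end_iff by blast
  then have "(b \<circ> x) (s + int n) = ball_vertex c (k - t - int n)" for n
    by (simp add: x algebra_simps)
  then show ?thesis using not_ascending_and_descending[OF _ down] by blast
qed

lemma pgl_act_ball_vertex:
  "pgl_act v M (ball_vertex c n) = hclass (matvec M ` ball_lattice c n 0)"
  unfolding ball_vertex_def by (rule pgl_act_hclass[OF lattice_ball_lattice])

lemma translation_ball_vertex: "pgl_act v (1, a, 0, 1) (ball_vertex c n) = ball_vertex (c + a) n"
proof -
  have "matvec (1, a, 0, 1) ` ball_lattice c n 0 = ball_lattice (c + a) n 0"
  proof (intro equalityI subsetI)
    fix z assume "z \<in> ball_lattice (c + a) n 0"
    then show "z \<in> matvec (1, a, 0, 1) ` ball_lattice c n 0"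
      by (intro image_eqI[of _ _ "(fst z - a * snd z, snd z)"])
         (auto simp: matvec_def ball_lattice_def algebra_simps)
  qed (auto simp: matvec_def ball_lattice_def algebra_simps)
  then show ?thesis by (simp add: pgl_act_ball_vertex hclass_ball_lattice)
qed

text \<open>With \<open>(s, b)\<close> read as the point \<open>s / b\<close>, the matrix is the map
  sending \<open>y\<close> to \<open>1 / (y - c)\<close>. It moves \<open>c\<close> to infinity, so
  balls shrinking to \<open>c\<close> become growing balls around 0.\<close>

lemma inversion_ball_vertex: "pgl_act v (0, 1, 1, - c) (ball_vertex c n) = ball_vertex 0 (- n)"
proof -
  have "matvec (0, 1, 1, - c) ` ball_lattice c n 0 = ball_lattice 0 (- n) n"
  proof (intro equalityI subsetI)
    fix z assume "z \<in> ball_lattice 0 (- n) n"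
    then show "z \<in> matvec (0, 1, 1, - c) ` ball_lattice c n 0"
      by (intro image_eqI[of _ _ "(snd z + c * fst z, fst z)"])
         (auto simp: matvec_def ball_lattice_def algebra_simps)
  qed (auto simp: matvec_def ball_lattice_def algebra_simps)
  then show ?thesis by (simp add: pgl_act_ball_vertex hclass_ball_lattice)
qed

text \<open>With the end of \<open>x\<close> at infinity, the path \<open>x\<close> joins
  \<open>c\<close> to infinity. As \<open>g\<close> moves that end, \<open>g\<close> sends it to
  some point \<open>c'\<close>, and translation by \<open>c' - c\<close> carries \<open>x\<close> to
  the path joining \<open>c'\<close> to infinity.\<close>

lemma ascending_translation:
  assumes x: "\<And>i. x i = ball_vertex c (k - i)" and path: "doubly_inf_path v x"
    and g: "g \<in> Ghat v e" "\<not> fixes_end g x"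
  shows "\<exists>n\<in>PGL v. fixes_end n x \<and> (\<exists>i. n (x i) = x i) \<and>
    (\<exists>i j. \<forall>m. g (x (i + int m)) = n (x (j - int m)))"
proof (rule path_dichotomy[OF Ghat_path[OF g(1) path]])
  fix k' c' assume y: "\<And>i. (g \<circ> x) i = ball_vertex c' (k' - i)"
  \<comment> \<open>Two ascending paths merge: all balls of level at most \<open>N\<close> around
    \<open>c\<close> and \<open>c'\<close> coincide. So \<open>g\<close> would fix the end, contrary
    to assumption.\<close>
  obtain N where N: "\<forall>m\<le>N. val_ge v (c' - c) m" using exists_val_ge by blast
  have "g (x (k' - N + int n)) = x (k - N + int n)" for n
    using y[of "k' - N + int n"] N by (simp add: x ball_vertex_eq_iff)
  then have "fixes_end g x" unfolding fixes_end_iff by blast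
  then show ?thesis using g(2) by blast
next
  fix i k' c' assume y: "\<And>m. (g \<circ> x) (i + int m) = ball_vertex c' (k' + int m)"
  define n where "n = pgl_act v (1, c' - c, 0, 1)"
  have n: "n (x i) = ball_vertex c' (k - i)" for i
    by (simp add: n_def x translation_ball_vertex)
  have "mdet (1, c' - c, 0, 1) \<noteq> 0" by (simp add: mdet_def)
  then have "n \<in> PGL v" unfolding PGL_def n_def by blast
  moreover obtain N where N: "\<forall>m\<le>N. val_ge v (c' - c) m" using exists_val_ge by blast
  \<comment> \<open>At these indices the level is at most \<open>N\<close>, so the ball contains
    both centres and the translation preserves it.\<close>
  have fixed: "n (x (k - N + int m)) = x (k - N + int m)" for m
    unfolding n unfolding x[of "k - N + int m"] ball_vertex_eq_iff using N by simp
  then have "fixes_end n x" unfolding fixes_end_iff by blast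
  moreover have "\<exists>i. n (x i) = x i" using fixed by blast
  moreover have "g (x (i + int m)) = n (x (k - k' - int m))" for m
    using y[of m] by (simp add: n)
  ultimately show ?thesis by blast
qed

text \<open>This normalization reduces statements about an arbitrary path to ascending ones. A path
  descending to \<open>c\<close> is turned around by the inversion that sends \<open>c\<close> to
  infinity.\<close>

lemma exists_ascending_translate:
  assumes path: "doubly_inf_path v x"
  shows "\<exists>m\<in>PGL v. \<exists>c k. \<forall>i. m (x i) = ball_vertex c (k - i)"
proof (rule path_dichotomy[OF path])
  fix k c assume x: "\<And>i. x i = ball_vertex c (k - i)"
  have "pgl_act v (1, 0, 0, 1) \<in> PGL v"
    unfolding PGL_def by (intro CollectI exI[of _ "(1, 0, 0, 1)"]) (simp add: mdet_def)
  moreover have "\<forall>i. pgl_act v (1, 0, 0, 1) (x i) = ball_vertex c (k - i)"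
    by (simp add: x translation_ball_vertex)
  ultimately show ?thesis by blast
next
  fix i k c assume x: "\<And>m. x (i + int m) = ball_vertex c (k + int m)"
  define m where "m = pgl_act v (0, 1, 1, - c)"
  have m: "m \<in> PGL v"
    unfolding PGL_def m_def by (intro CollectI exI[of _ "(0, 1, 1, - c)"]) (simp add: mdet_def)
  have up: "(m \<circ> x) (i + int n) = ball_vertex 0 (- k - int n)" for n
    by (simp add: x m_def inversion_ball_vertex)
  show ?thesis
  \<comment> \<open>So far only a tail is known to ascend. The dichotomy extends this to the whole
    path, since a descending tail is incompatible with it.\<close>
  proof (rule path_dichotomy[OF Ghat_path[OF PGL_Ghat[OF m] path]])
    fix k' c' assume "\<And>i. (m \<circ> x) i = ball_vertex c' (k' - i)"
    then have "\<forall>i. m (x i) = ball_vertex c' (k' - i)" by simp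
    then show ?thesis using m by blast
  next
    fix i' k' c' assume "\<And>n. (m \<circ> x) (i' + int n) = ball_vertex c' (k' + int n)"
    from not_ascending_and_descending[OF up this] show ?thesis by (rule FalseE)
  qed
qed

lemma path_inj:
  assumes "doubly_inf_path v x"
  shows "x i = x j \<longleftrightarrow> i = j"
proof
  assume ij: "x i = x j"
  obtain m c k where m: "\<forall>i. m (x i) = ball_vertex c (k - i)"
    using exists_ascending_translate[OF assms] by blast
  then have "ball_vertex c (k - i) = ball_vertex c (k - j)" using ij by metis
  then show "i = j" by (simp add: ball_vertex_eq_iff)
qed simp

text \<open>Conjugation by \<open>m\<close> replaces the path \<open>x\<close> by
  \<open>m \<circ> x\<close>, which allows transfer to the ascending case.\<close>

lemma conjugate_apply:
  assumes "m \<in> Ghat v e"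
  shows "(m \<circ> g \<circ> inv m) ((m \<circ> x) i) = (m \<circ> x) j \<longleftrightarrow> g (x i) = x j"
  using Ghat_bij[OF assms] Ghat_inv_left[OF assms] by (simp add: bij_is_inj inj_eq)

lemma conjugate_fixes_end:
  assumes "m \<in> Ghat v e"
  shows "fixes_end (m \<circ> g \<circ> inv m) (m \<circ> x) \<longleftrightarrow> fixes_end g x"
  unfolding fixes_end_iff conjugate_apply[OF assms] by (rule refl)

lemma Bhat_shift:
  assumes path: "doubly_inf_path v x" and b: "b \<in> Bhat v e x" and ij: "b (x i) = x j"
  shows "b (x (i + int n)) = x (j + int n)"
proof -
  obtain m c k where m: "m \<in> PGL v" and x: "\<forall>i. m (x i) = ball_vertex c (k - i)"
    using exists_ascending_translate[OF path] by blast
  have mG: "m \<in> Ghat v e" by (rule PGL_Ghat[OF m])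
  have bG: "b \<in> Ghat v e" "fixes_end b x" using b unfolding Bhat_def by blast+
  have "(m \<circ> b \<circ> inv m) ((m \<circ> x) (i + int n)) = (m \<circ> x) (j + int n)"
  proof (rule ascending_shift)
    show "(m \<circ> x) i = ball_vertex c (k - i)" for i using x by simp
    show "doubly_inf_path v (m \<circ> x)" by (rule Ghat_path[OF mG path])
    show "m \<circ> b \<circ> inv m \<in> Ghat v e" by (intro Ghat_comp mG bG Ghat_inv)
    show "fixes_end (m \<circ> b \<circ> inv m) (m \<circ> x)"
      unfolding conjugate_fixes_end[OF mG] by (rule bG)
    show "(m \<circ> b \<circ> inv m) ((m \<circ> x) i) = (m \<circ> x) j"
      unfolding conjugate_apply[OF mG] by (rule ij)
  qed
  then show ?thesis unfolding conjugate_apply[OF mG] .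
qed

text \<open>Every end other than \<omega> is the image of \<omega>' under some element of
  \<open>Nhat\<close>; here the end is \<open>g\<close> applied to \<omega>. After conjugation the
  element is a translation.\<close>

lemma Nhat_reverses:
  assumes path: "doubly_inf_path v x" and g: "g \<in> Ghat v e" "g \<notin> Bhat v e x"
  shows "\<exists>n\<in>Nhat v e x. \<exists>i j. \<forall>l. g (x (i + int l)) = n (x (j - int l))"
proof -
  obtain m c k where m: "m \<in> PGL v" and x: "\<forall>i. m (x i) = ball_vertex c (k - i)"
    using exists_ascending_translate[OF path] by blast
  have mG: "m \<in> Ghat v e" by (rule PGL_Ghat[OF m])
  have "\<not> fixes_end (m \<circ> g \<circ> inv m) (m \<circ> x)"
    using g unfolding conjugate_fixes_end[OF mG] Bhat_def by blast
  moreover have "m \<circ> g \<circ> inv m \<in> Ghat v e" by (intro Ghat_comp mG g Ghat_inv)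
  moreover have "(m \<circ> x) i = ball_vertex c (k - i)" for i using x by simp
  ultimately have "\<exists>n\<in>PGL v. fixes_end n (m \<circ> x) \<and> (\<exists>i. n ((m \<circ> x) i) = (m \<circ> x) i) \<and>
    (\<exists>i j. \<forall>l. (m \<circ> g \<circ> inv m) ((m \<circ> x) (i + int l)) = n ((m \<circ> x) (j - int l)))"
    by (intro ascending_translation[of _ c k _ e] Ghat_path[OF mG path])
  then obtain n i0 i j where n: "n \<in> PGL v" "fixes_end n (m \<circ> x)" "n (m (x i0)) = m (x i0)"
    and nl: "\<forall>l. (m \<circ> g \<circ> inv m) ((m \<circ> x) (i + int l)) = n ((m \<circ> x) (j - int l))"
    unfolding comp_apply by blast
  define n' where "n' = inv m \<circ> n \<circ> m"
  have "n' \<in> Ghat v e" unfolding n'_def by (intro Ghat_comp Ghat_inv mG PGL_Ghat[OF n(1)])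
  moreover have "n = m \<circ> n' \<circ> inv m"
    unfolding n'_def by (simp add: fun_eq_iff Ghat_inv_right[OF mG])
  then have "fixes_end n' x" using n(2) conjugate_fixes_end[OF mG] by metis
  moreover have "n' (x i0) = x i0"
    unfolding n'_def by (simp add: n(3) Ghat_inv_left[OF mG])
  ultimately have "n' \<in> Nhat v e x" unfolding Nhat_def Bhat_def by blast
  moreover have "g (x (i + int l)) = n' (x (j - int l))" for l
  proof -
    have "m (g (x (i + int l))) = n (m (x (j - int l)))"
      using nl[rule_format, of l] by (simp add: Ghat_inv_left[OF mG])
    then show ?thesis
      unfolding n'_def comp_apply using Ghat_inv_left[OF mG] by metis
  qed
  ultimately show ?thesis by blast
qed

section \<open>Group properties of \<open>Bhat\<close>, \<open>Nhat\<close> and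
  \<open>Hhat\<close>\<close>

section \<open>The subgroups\<close>

lemma Bhat_Ghat: "b \<in> Bhat v e x \<Longrightarrow> b \<in> Ghat v e"
  unfolding Bhat_def by blast

lemma Bhat_comp: "b \<in> Bhat v e x \<Longrightarrow> b' \<in> Bhat v e x \<Longrightarrow> b \<circ> b' \<in> Bhat v e x"
  unfolding Bhat_def by (blast intro: Ghat_comp fixes_end_comp)

lemma Bhat_inv: "b \<in> Bhat v e x \<Longrightarrow> inv b \<in> Bhat v e x"
  unfolding Bhat_def by (blast intro: Ghat_inv fixes_end_inv)

lemma Nhat_Bhat: "n \<in> Nhat v e x \<Longrightarrow> n \<in> Bhat v e x"
  unfolding Nhat_def by blast

lemma Nhat_Ghat: "n \<in> Nhat v e x \<Longrightarrow> n \<in> Ghat v e"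
  by (rule Bhat_Ghat[OF Nhat_Bhat])

text \<open>An element of \<open>Nhat\<close> that fixes one \<open>x i\<close> fixes all later
  vertices of the path, so both factors fix the vertex at the larger index.\<close>

lemma Nhat_comp:
  assumes path: "doubly_inf_path v x" and n: "n \<in> Nhat v e x" "n' \<in> Nhat v e x"
  shows "n \<circ> n' \<in> Nhat v e x"
proof -
  obtain i j where ij: "n (x i) = x i" "n' (x j) = x j" using n unfolding Nhat_def by blast
  have "n (x (max i j)) = x (max i j)" "n' (x (max i j)) = x (max i j)"
    using Bhat_shift[OF path Nhat_Bhat[OF n(1)] ij(1), of "nat (max i j - i)"]
      Bhat_shift[OF path Nhat_Bhat[OF n(2)] ij(2), of "nat (max i j - j)"] by simp_all
  then have "(n \<circ> n') (x (max i j)) = x (max i j)" by simp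
  moreover have "n \<circ> n' \<in> Bhat v e x" using n by (intro Bhat_comp Nhat_Bhat)
  ultimately show ?thesis unfolding Nhat_def by blast
qed

lemma Nhat_inv:
  assumes "n \<in> Nhat v e x"
  shows "inv n \<in> Nhat v e x"
proof -
  obtain i where "n (x i) = x i" using assms unfolding Nhat_def by blast
  then have "inv n (x i) = x i"
    using Ghat_inv_left[OF Nhat_Ghat[OF assms]] by metis
  then show ?thesis using Bhat_inv[OF Nhat_Bhat[OF assms]] unfolding Nhat_def by blast
qed

text \<open>Fixing the path pointwise is a shift by 0, which fixes its end.\<close>

lemma Hhat_eq:
  "Hhat v e x = {h \<in> Ghat v e. \<forall>k. h (x k) = x k}"
proof -
  have "fixes_end h x" if "\<forall>k. h (x k) = x k" for h
    unfolding fixes_end_iff using that by blast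
  then show ?thesis unfolding Hhat_def Nhat_def Bhat_def by blast
qed

lemma Hhat_comp: "h \<in> Hhat v e x \<Longrightarrow> h' \<in> Hhat v e x \<Longrightarrow> h \<circ> h' \<in> Hhat v e x"
  unfolding Hhat_eq by (simp add: Ghat_comp)

lemma Hhat_inv: "h \<in> Hhat v e x \<Longrightarrow> inv h \<in> Hhat v e x"
  unfolding Hhat_eq mem_Collect_eq by (metis Ghat_inv Ghat_inv_left)

lemma id_Hhat: "id \<in> Hhat v e x"
proof -
  have "pgl_act v (1, 0, 0, 1) = id"
    by (auto simp: fun_eq_iff pgl_act_def matvec_def)
  moreover have "pgl_act v (1, 0, 0, 1) \<in> PGL v"
    unfolding PGL_def by (intro CollectI exI[of _ "(1, 0, 0, 1)"]) (simp add: mdet_def)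
  ultimately show ?thesis using PGL_Ghat by (simp add: Hhat_eq)
qed

lemma Hhat_coset_eq:
  assumes "h \<in> Hhat v e x"
  shows "(\<lambda>h'. n \<circ> h \<circ> h') ` Hhat v e x = (\<lambda>h'. n \<circ> h') ` Hhat v e x"
proof (intro equalityI subsetI)
  fix f assume "f \<in> (\<lambda>h'. n \<circ> h \<circ> h') ` Hhat v e x"
  then obtain h' where "f = n \<circ> (h \<circ> h')" "h' \<in> Hhat v e x" by (auto simp: comp_assoc)
  then show "f \<in> (\<lambda>h'. n \<circ> h') ` Hhat v e x" using Hhat_comp[OF assms] by blast
next
  fix f assume "f \<in> (\<lambda>h'. n \<circ> h') ` Hhat v e x"
  then obtain h' where f: "f = n \<circ> h'" "h' \<in> Hhat v e x" by blast
  have "h \<in> Ghat v e" using assms unfolding Hhat_eq by blast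
  then have "f = n \<circ> h \<circ> (inv h \<circ> h')"
    unfolding f by (simp add: fun_eq_iff)
  moreover have "inv h \<circ> h' \<in> Hhat v e x" using Hhat_comp Hhat_inv assms f(2) by blast
  ultimately show "f \<in> (\<lambda>h'. n \<circ> h \<circ> h') ` Hhat v e x" by blast
qed

section \<open>The two cells, and the cosets in the big cell\<close>

section \<open>The decomposition\<close>

context
  fixes e :: nat and x :: "int \<Rightarrow> ('f \<times> 'f) set set"
    and \<alpha> :: "('f \<times> 'f) set set \<Rightarrow> ('f \<times> 'f) set set"
  assumes path: "doubly_inf_path v x"
    and \<alpha>: "\<alpha> \<in> Ghat v e"
    and \<alpha>_x: "\<alpha> (x k) = x (- k)"
begin

lemma inv_\<alpha>_x: "inv \<alpha> (x k) = x (- k)"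
  using Ghat_inv_left[OF \<alpha>, of "x (- k)"] \<alpha>_x[of "- k"] by simp

text \<open>A tail on which \<alpha> acts as a shift would need \<open>- (i + n) = j + n\<close> for
  all \<open>n\<close>, which fails for one of 0 and 1.\<close>

lemma \<alpha>_notin_Bhat: "\<alpha> \<notin> Bhat v e x"
proof
  assume "\<alpha> \<in> Bhat v e x"
  then obtain i j where ij: "\<forall>n. \<alpha> (x (i + int n)) = x (j + int n)"
    unfolding Bhat_def fixes_end_iff by blast
  then have "- (i + int n) = j + int n" for n
    unfolding \<alpha>_x path_inj[OF path] by blast
  from this[of 0] this[of 1] show False by simp
qed

lemma Ghat_decomposition:
  assumes g: "g \<in> Ghat v e" "g \<notin> Bhat v e x"
  shows "\<exists>n\<in>Nhat v e x. \<exists>b\<in>Bhat v e x. g = n \<circ> \<alpha> \<circ> b"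
proof -
  obtain n i j where n: "n \<in> Nhat v e x" and gn: "\<forall>l. g (x (i + int l)) = n (x (j - int l))"
    using Nhat_reverses[OF path g] by blast
  have nG: "n \<in> Ghat v e" by (rule Nhat_Ghat[OF n])
  \<comment> \<open>The path is reversed by \<alpha>, which therefore exchanges \<omega> and
    \<omega>'. As \<open>n\<close> takes \<omega>' to the image of \<omega> under \<open>g\<close>,
    this \<open>b\<close> fixes \<omega>.\<close>
  define b where "b = inv \<alpha> \<circ> (inv n \<circ> g)"
  have "b (x (i + int l)) = x (- j + int l)" for l
    unfolding b_def using gn by (simp add: Ghat_inv_left[OF nG] inv_\<alpha>_x)
  then have "fixes_end b x" unfolding fixes_end_iff by blast
  moreover have "b \<in> Ghat v e" unfolding b_def by (intro Ghat_comp Ghat_inv \<alpha> nG g)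
  ultimately have "b \<in> Bhat v e x" unfolding Bhat_def by blast
  moreover have "g = n \<circ> \<alpha> \<circ> b"
    unfolding b_def by (simp add: fun_eq_iff Ghat_inv_right[OF nG] Ghat_inv_right[OF \<alpha>])
  ultimately show ?thesis using n by blast
qed

text \<open>Otherwise, as \<open>Bhat\<close> is a group, cancelling \<open>n\<close> and
  \<open>b\<close> would put \<alpha> in it.\<close>

lemma big_cell_disjoint:
  assumes n: "n \<in> Nhat v e x" and b: "b \<in> Bhat v e x"
  shows "n \<circ> \<alpha> \<circ> b \<notin> Bhat v e x"
proof
  assume A: "n \<circ> \<alpha> \<circ> b \<in> Bhat v e x"
  have nB: "n \<in> Bhat v e x" by (rule Nhat_Bhat[OF n])
  have "\<alpha> = inv n \<circ> (n \<circ> \<alpha> \<circ> b) \<circ> inv b"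
    by (simp add: fun_eq_iff Ghat_inv_left[OF Bhat_Ghat[OF nB]] Ghat_inv_right[OF Bhat_Ghat[OF b]])
  also have "\<dots> \<in> Bhat v e x" by (intro Bhat_comp Bhat_inv nB b A)
  finally show False using \<alpha>_notin_Bhat by blast
qed

text \<open>Conjugating \<open>b\<close> by \<alpha> shows that \<open>n\<close> also shifts the
  tail towards \<omega>'. Elements of \<open>Bhat\<close> propagate a shift towards \<omega>, where
  the fixed vertex makes it 0.\<close>

lemma Nhat_conjugate_Hhat:
  assumes n: "n \<in> Nhat v e x" and b: "b \<in> Bhat v e x" and eq: "n \<circ> \<alpha> = \<alpha> \<circ> b"
  shows "n \<in> Hhat v e x"
proof -
  obtain i where i: "n (x i) = x i" using n unfolding Nhat_def by blast
  note nB = Nhat_Bhat[OF n]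
  obtain p q where b_x: "\<forall>l. b (x (p + int l)) = x (q + int l)"
    using b unfolding Bhat_def fixes_end_iff by blast
  have n_x: "n (x (- p - int l)) = x (- q - int l)" for l
    using fun_cong[OF eq, of "x (p + int l)"] b_x by (simp add: \<alpha>_x)
  have "p = q"
  proof -
    \<comment> \<open>Both shifts are compared at the common index \<open>max i (- p)\<close>, and
      injectivity of the path equates them.\<close>
    define s where "s = nat (i - (- p))"
    define t where "t = nat (- p - i)"
    have "n (x (- p + int s)) = x (- q + int s)" "n (x (i + int t)) = x (i + int t)"
      using Bhat_shift[OF path nB, of "- p" "- q"] n_x[of 0] Bhat_shift[OF path nB i] by simp_all
    moreover have "- p + int s = i + int t" by (simp add: s_def t_def)
    ultimately have "- q + int s = - p + int s" using path_inj[OF path] by metis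
    then show ?thesis by simp
  qed
  have "n (x k) = x k" for k
  proof -
    \<comment> \<open>This starts at or before \<open>k\<close> on the tail towards \<omega>', where
      \<open>n\<close> is known to fix vertices, and propagates forward to \<open>k\<close>.\<close>
    define l where "l = nat (- p - k)"
    have l: "- p - int l \<le> k" by (simp add: l_def)
    have "n (x (- p - int l)) = x (- p - int l)" using n_x \<open>p = q\<close> by simp
    from Bhat_shift[OF path nB this, of "nat (k - (- p - int l))"]
    show ?thesis using l by simp
  qed
  then show ?thesis using n unfolding Hhat_def by blast
qed

lemma big_cell_cosets:
  assumes n: "n1 \<in> Nhat v e x" "n2 \<in> Nhat v e x"
  shows "{n1 \<circ> \<alpha> \<circ> b | b. b \<in> Bhat v e x} \<inter> {n2 \<circ> \<alpha> \<circ> b | b. b \<in> Bhat v e x} \<noteq> {} \<longleftrightarrow>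
    (\<lambda>h. n1 \<circ> h) ` Hhat v e x = (\<lambda>h. n2 \<circ> h) ` Hhat v e x" (is "?L \<longleftrightarrow> ?R")
proof
  assume ?L
  then obtain b1 b2 where b: "b1 \<in> Bhat v e x" "b2 \<in> Bhat v e x"
    and eq: "n1 \<circ> \<alpha> \<circ> b1 = n2 \<circ> \<alpha> \<circ> b2" by auto
  \<comment> \<open>A common element gives the relation between \<open>inv n2 \<circ> n1\<close> and
    \<open>b2 \<circ> inv b1\<close> that forces the former into \<open>Hhat\<close>.\<close>
  have "(inv n2 \<circ> n1) \<circ> \<alpha> = inv n2 \<circ> (n1 \<circ> \<alpha> \<circ> b1) \<circ> inv b1"
    by (simp add: fun_eq_iff Ghat_inv_right[OF Bhat_Ghat[OF b(1)]])
  also have "\<dots> = \<alpha> \<circ> (b2 \<circ> inv b1)"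
    unfolding eq by (simp add: fun_eq_iff Ghat_inv_left[OF Nhat_Ghat[OF n(2)]])
  finally have "inv n2 \<circ> n1 \<in> Hhat v e x"
    by (rule Nhat_conjugate_Hhat[rotated 2])
       (use n b path in \<open>blast intro: Nhat_comp Nhat_inv Bhat_comp Bhat_inv\<close>)+
  from Hhat_coset_eq[OF this, of n2] show ?R
    by (simp add: comp_def Ghat_inv_right[OF Nhat_Ghat[OF n(2)]])
next
  assume ?R
  then have "n1 \<circ> id \<in> (\<lambda>h. n2 \<circ> h) ` Hhat v e x" using id_Hhat by blast
  then obtain h where h: "h \<in> Ghat v e" "\<forall>k. h (x k) = x k" and n1: "n1 = n2 \<circ> h"
    unfolding Hhat_eq by auto
  \<comment> \<open>Since \<alpha> permutes the vertices of the path, it normalizes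
    \<open>Hhat\<close>, so \<open>h\<close> can be moved past \<alpha> into
    \<open>Bhat\<close>.\<close>
  define b where "b = inv \<alpha> \<circ> h \<circ> \<alpha>"
  have "b (x k) = x k" for k unfolding b_def by (simp add: \<alpha>_x h(2) inv_\<alpha>_x)
  moreover have "b \<in> Ghat v e" unfolding b_def by (intro Ghat_comp Ghat_inv \<alpha> h)
  ultimately have "b \<in> Hhat v e x" unfolding Hhat_eq by blast
  then have "b \<in> Bhat v e x" "id \<in> Bhat v e x"
    using id_Hhat unfolding Hhat_def Nhat_def by blast+
  moreover have "n1 \<circ> \<alpha> \<circ> id = n2 \<circ> \<alpha> \<circ> b"
    unfolding b_def n1 by (simp add: fun_eq_iff Ghat_inv_right[OF \<alpha>])
  ultimately show ?L by blast
qed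

end

end

theorem mainTheorem11:
  fixes v :: "'f::field \<Rightarrow> int" and e :: nat
    and x :: "int \<Rightarrow> ('f \<times> 'f) set set"
    and \<alpha> :: "('f \<times> 'f) set set \<Rightarrow> ('f \<times> 'f) set set"
  assumes "nonarch_local_field v"
    and "1 \<le> e"
    and "doubly_inf_path v x"
    and "\<alpha> \<in> Ghat v e"
    and "\<forall>n. \<alpha> (x n) = x (- n)"
  shows "Ghat v e = {n \<circ> \<alpha> \<circ> b | n b. n \<in> Nhat v e x \<and> b \<in> Bhat v e x} \<union> Bhat v e x
     \<and> {n \<circ> \<alpha> \<circ> b | n b. n \<in> Nhat v e x \<and> b \<in> Bhat v e x} \<inter> Bhat v e x = {}
     \<and> (\<forall>n1\<in>Nhat v e x. \<forall>n2\<in>Nhat v e x.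
          ({n1 \<circ> \<alpha> \<circ> b | b. b \<in> Bhat v e x} \<inter> {n2 \<circ> \<alpha> \<circ> b | b. b \<in> Bhat v e x} \<noteq> {})
          \<longleftrightarrow> (\<lambda>h. n1 \<circ> h) ` Hhat v e x = (\<lambda>h. n2 \<circ> h) ` Hhat v e x)"
proof -
  interpret nonarch_field v by unfold_locales (rule assms(1))
  note hyps = assms(3,4) assms(5)[rule_format]
  have "n \<circ> \<alpha> \<circ> b \<in> Ghat v e" if "n \<in> Nhat v e x" "b \<in> Bhat v e x" for n b
    using that assms(4) by (intro Ghat_comp) (blast intro: Bhat_Ghat Nhat_Ghat)+
  then have "Ghat v e = {n \<circ> \<alpha> \<circ> b | n b. n \<in> Nhat v e x \<and> b \<in> Bhat v e x} \<union> Bhat v e x"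
    using Ghat_decomposition[where x = x and \<alpha> = \<alpha>, OF hyps] Bhat_Ghat by blast
  moreover have "{n \<circ> \<alpha> \<circ> b | n b. n \<in> Nhat v e x \<and> b \<in> Bhat v e x} \<inter> Bhat v e x = {}"
    using big_cell_disjoint[where x = x and \<alpha> = \<alpha>, OF hyps] by blast
  moreover note big_cell_cosets[where x = x and \<alpha> = \<alpha>, OF hyps]
  ultimately show ?thesis by (intro conjI ballI)
qed

end
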